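(* For all integers $n\ge 1$ and $k\ge 1$, the number $B_{n,k}$ of Dyck paths of order $n$ which hit or cross the line $y=x+k$ is given by $$B_{n,k}=\sum_{j=1}^{\left\lfloor\frac{n+1}{k+1}\right\rfloor}\binom{2n+2}{n+1-j(k+1)}-4\sum_{j=1}^{\left\lfloor\frac{n}{k+1}\right\rfloor}\binom{2n}{n-j(k+1)}.$$
   Context: A Dyck path of order $n\ge 1$ is a lattice path in the plane from $(0,0)$ to $(n,n)$ consisting of $2n$ unit steps, each going either up (adding $(0,1)$) or to the right (adding $(1,0)$), that never goes below the diagonal $y=x$ (touching the diagonal is allowed). $B_{n,k}$ denotes the number of Dyck paths of order $n$ which hit or cross the line $y=x+k$, i.e. which visit at least one lattice point $(x,y)$ with $y-x\ge k$; in particular $B_{n,k}=0$ for $k>n$. Equivalently, $B_{n,k}$ is the number of sequences $a_1,\dots,a_{2n}$ of nonnegative integers with $a_1=1$, $a_{2n}=0$, $|a_i-a_{i+1}|=1$ for $1\le i<2n$, in which the value $k$ occurs at least once. Empty sums are $0$. *)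

theory Defs
  imports Complex_Main
begin

datatype step = Up | Rt

fun move :: "step \<Rightarrow> nat \<times> nat \<Rightarrow> nat \<times> nat" where
  "move Up (x, y) = (x, y + 1)"
| "move Rt (x, y) = (x + 1, y)"

fun visited :: "nat \<times> nat \<Rightarrow> step list \<Rightarrow> (nat \<times> nat) list" where
  "visited P [] = [P]"
| "visited P (s # ss) = P # visited (move s P) ss"

text \<open>Since every step joins two neighbouring lattice points, it suffices to compare a path
  with a line \<open>y = x + k\<close> at the lattice points that the path visits.\<close>

definition dyck_path :: "nat \<Rightarrow> step list \<Rightarrow> bool" where
  "dyck_path n p \<longleftrightarrow>
     length p = 2 * n \<and>
     last (visited (0, 0) p) = (n, n) \<and>
     (\<forall>(x, y) \<in> set (visited (0, 0) p). x \<le> y)"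

definition hits_or_crosses :: "nat \<Rightarrow> step list \<Rightarrow> bool" where
  "hits_or_crosses k p \<longleftrightarrow> (\<exists>(x, y) \<in> set (visited (0, 0) p). y \<ge> x + k)"

definition B :: "nat \<Rightarrow> nat \<Rightarrow> nat" where
  "B n k = card {p. dyck_path n p \<and> hits_or_crosses k p}"

end

theory Submission
  imports Defs
begin

text \<open>A path is recorded by its heights \<open>y - x\<close>. A Dyck path of order \<open>n\<close> never exceeds height
  \<open>n\<close>, so \<open>B n k\<close> is the difference between the numbers of paths that stay in the strips
  \<open>{0..<n + 1}\<close> and \<open>{0..<k}\<close>. Both are instances of one reflection count.

  Walks confined to \<open>{0..<k}\<close> are walks killed at \<open>-1\<close> and at \<open>k\<close>. Reflections in these two
  barriers compose to translations by multiples of \<open>2(k + 1)\<close>, so the confined count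
  is a difference of two counts of free walks on the cycle of length \<open>2(k + 1)\<close>
  (lemma \<open>card_strip_walks\<close>): with \<open>W s d\<close> the number of \<open>s\<close>-step walks on the cycle between
  points at distance \<open>d\<close>, the number of confined walks from \<open>a\<close> to \<open>0\<close> is
  \<open>W s a - W s (a + 2)\<close>.

  For closed paths this is \<open>W (2n) 0 - W (2n) 2\<close>. Splitting off two steps gives
  \<open>W (2n+2) 0 = 2 W (2n) 0 + 2 W (2n) 2\<close>, hence twice the confined count is
  \<open>4 W (2n) 0 - W (2n+2) 0\<close>: this is where the factor \<open>4\<close> and the row \<open>2n + 2\<close> of the formula
  come from. Finally \<open>W (2n) 0\<close> is the sum of the binomials \<open>2n choose i\<close> over
  \<open>i\<close> congruent to \<open>n\<close> modulo \<open>k + 1\<close> (lemma \<open>cycle_walks_closed\<close>), and by symmetry of the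
  binomials everything but the central one occurs twice. The central terms are independent of
  the strip and cancel in the difference; the strip of width \<open>n + 1\<close> contributes no other terms.\<close>

section \<open>Walks on a cycle\<close>

text \<open>The number of \<open>s\<close>-step walks with steps \<open>\<plusminus>1\<close> from \<open>0\<close> to \<open>d\<close> in the integers
  modulo \<open>M\<close>.\<close>

fun cycle_walks :: "int \<Rightarrow> nat \<Rightarrow> int \<Rightarrow> int" where
  "cycle_walks M 0 d = of_bool (M dvd d)"
| "cycle_walks M (Suc s) d = cycle_walks M s (d + 1) + cycle_walks M s (d - 1)"

lemma cycle_walks_minus: "cycle_walks M s (- d) = cycle_walks M s d"
proof (induction s arbitrary: d)
  case (Suc s)
  have "- d + 1 = - (d - 1)" "- d - 1 = - (d + 1)" by simp_all
  then show ?case by (simp only: cycle_walks.simps Suc add.commute)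
qed simp

lemma cycle_walks_periodic: "cycle_walks M s (d + M) = cycle_walks M s d"
proof (induction s arbitrary: d)
  case (Suc s)
  from Suc[of "d + 1"] Suc[of "d - 1"] show ?case by (simp add: algebra_simps)
qed simp

text \<open>A walk with \<open>i\<close> steps of one sign has displacement \<open>\<plusminus>(s - 2i)\<close>; the induction is
  Pascal's rule.\<close>

lemma cycle_walks_binomial:
  "cycle_walks M s d = (\<Sum>i\<le>s. of_bool (M dvd d + int s - 2 * int i) * int (s choose i))"
proof (induction s arbitrary: d)
  case (Suc s)
  let ?b = "\<lambda>i. of_bool (M dvd d + int (Suc s) - 2 * int i) :: int"
  have up: "cycle_walks M s (d + 1) = (\<Sum>i\<le>s. ?b i * int (s choose i))"
    unfolding Suc by (intro sum.cong refl) (simp add: algebra_simps)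
  have down: "cycle_walks M s (d - 1) = (\<Sum>i\<le>s. ?b (Suc i) * int (s choose i))"
    unfolding Suc by (intro sum.cong refl) (simp add: algebra_simps)
  have "(\<Sum>i\<le>Suc s. ?b i * int (Suc s choose i))
      = ?b 0 + (\<Sum>i\<le>s. ?b (Suc i) * int (Suc s choose Suc i))"
    by (subst sum.atMost_Suc_shift) simp
  also have "\<dots> = (?b 0 + (\<Sum>i\<le>s. ?b (Suc i) * int (s choose Suc i)))
      + (\<Sum>i\<le>s. ?b (Suc i) * int (s choose i))"
    by (simp add: distrib_left sum.distrib del: of_nat_Suc)
  also have "?b 0 + (\<Sum>i\<le>s. ?b (Suc i) * int (s choose Suc i))
      = (\<Sum>i\<le>Suc s. ?b i * int (s choose i))"
    by (subst sum.atMost_Suc_shift) simp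
  also have "\<dots> = (\<Sum>i\<le>s. ?b i * int (s choose i))"
    by (subst sum.atMost_Suc) simp
  finally show ?case
    unfolding cycle_walks.simps up down by simp
qed simp

lemma sum_multiples:
  fixes f :: "nat \<Rightarrow> 'a::comm_monoid_add"
  assumes "m > 0"
  shows "sum f {i. 1 \<le> i \<and> i \<le> n \<and> m dvd i} = (\<Sum>j = 1..n div m. f (j * m))"
proof (rule sum.reindex_bij_witness[of _ "\<lambda>j. j * m" "\<lambda>i. i div m"])
  fix j assume "j \<in> {1..n div m}"
  moreover from this have "j * m \<le> n"
    using assms by (simp add: less_eq_div_iff_mult_less_eq)
  ultimately show "j * m \<in> {i. 1 \<le> i \<and> i \<le> n \<and> m dvd i}"
    using assms by simp
next
  fix i assume "i \<in> {i. 1 \<le> i \<and> i \<le> n \<and> m dvd i}"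
  then show "i div m \<in> {1..n div m}"
    using assms by (auto simp: div_le_mono dvd_imp_le div_greater_zero_iff Suc_le_eq)
qed (use assms in auto)

lemma cycle_walks_closed:
  assumes "m > 0"
  shows "cycle_walks (2 * int m) (2 * n) 0
    = int ((2 * n) choose n) + 2 * (\<Sum>j = 1..n div m. int ((2 * n) choose (n - j * m)))"
proof -
  let ?f = "\<lambda>i. of_bool (int m dvd int n - int i) * int ((2 * n) choose i)"
  let ?D = "{i. 1 \<le> i \<and> i \<le> n \<and> m dvd i}"
  have "cycle_walks (2 * int m) (2 * n) 0 = sum ?f {..2 * n}"
  proof -
    have "(2 * int m dvd 2 * int n - 2 * int i) \<longleftrightarrow> int m dvd int n - int i" for i
      using dvd_mult_cancel_left[of 2 "int m" "int n - int i"] by (simp add: algebra_simps)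
    then show ?thesis by (simp add: cycle_walks_binomial)
  qed
  also have "{..2 * n} = {n} \<union> ((\<lambda>i. n - i) ` {1..n} \<union> (\<lambda>i. n + i) ` {1..n})"
  proof -
    have "i \<in> (\<lambda>i. n - i) ` {1..n}" if "i < n" for i
      using that by (intro image_eqI[of _ _ "n - i"]) auto
    moreover have "i \<in> (\<lambda>i. n + i) ` {1..n}" if "n < i" "i \<le> 2 * n" for i
      using that by (intro image_eqI[of _ _ "i - n"]) auto
    ultimately show ?thesis by (fastforce simp: not_less)
  qed
  also have "sum ?f \<dots> = ?f n + (sum ?f ((\<lambda>i. n - i) ` {1..n}) + sum ?f ((\<lambda>i. n + i) ` {1..n}))"
    by (subst sum.union_disjoint, simp, simp, fastforce)
      (subst sum.union_disjoint, auto)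
  also have "sum ?f ((\<lambda>i. n - i) ` {1..n}) = (\<Sum>i\<in>?D. int ((2 * n) choose (n - i)))"
  proof -
    have "sum ?f ((\<lambda>i. n - i) ` {1..n}) = (\<Sum>i = 1..n. ?f (n - i))"
      by (subst sum.reindex) (auto intro!: inj_onI)
    also have "\<dots> = (\<Sum>i = 1..n. if m dvd i then int ((2 * n) choose (n - i)) else 0)"
      by (intro sum.cong refl) (auto simp: of_nat_diff)
    also have "\<dots> = (\<Sum>i\<in>?D. int ((2 * n) choose (n - i)))"
      by (rule sum.mono_neutral_cong_right) auto
    finally show ?thesis .
  qed
  also have "sum ?f ((\<lambda>i. n + i) ` {1..n}) = (\<Sum>i\<in>?D. int ((2 * n) choose (n - i)))"
  proof -
    have "sum ?f ((\<lambda>i. n + i) ` {1..n}) = (\<Sum>i = 1..n. ?f (n + i))"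
      by (subst sum.reindex) auto
    also have "\<dots> = (\<Sum>i = 1..n. if m dvd i then int ((2 * n) choose (n - i)) else 0)"
    proof (intro sum.cong refl)
      fix i assume "i \<in> {1..n}"
      then have "(2 * n) choose (n + i) = (2 * n) choose (n - i)"
        by (subst binomial_symmetric) (auto simp: mult_2)
      then show "?f (n + i) = (if m dvd i then int ((2 * n) choose (n - i)) else 0)"
        by simp
    qed
    also have "\<dots> = (\<Sum>i\<in>?D. int ((2 * n) choose (n - i)))"
      by (rule sum.mono_neutral_cong_right) auto
    finally show ?thesis .
  qed
  also have "(\<Sum>i\<in>?D. int ((2 * n) choose (n - i)))
      = (\<Sum>j = 1..n div m. int ((2 * n) choose (n - j * m)))"
    by (rule sum_multiples[OF assms])
  finally show ?thesis by simp
qed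

lemma cycle_walks_two_steps:
  "cycle_walks M (s + 2) 0 = 2 * cycle_walks M s 0 + 2 * cycle_walks M s 2"
  using cycle_walks_minus[of M s 2] by (simp add: numeral_2_eq_2)

section \<open>Walks in a strip\<close>

fun heights :: "int \<Rightarrow> step list \<Rightarrow> int list" where
  "heights h [] = [h]"
| "heights h (s # ss) = h # heights (case s of Up \<Rightarrow> h + 1 | Rt \<Rightarrow> h - 1) ss"

lemma heights_not_Nil [simp]: "heights h p \<noteq> []"
  by (cases p) auto

lemma start_in_heights [simp]: "h \<in> set (heights h p)"
  by (cases p) auto

definition strip_walks :: "nat \<Rightarrow> nat \<Rightarrow> int \<Rightarrow> step list set" where
  "strip_walks k s a =
    {p. length p = s \<and> last (heights a p) = 0 \<and> set (heights a p) \<subseteq> {0..<int k}}"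

lemma strip_walks_outside: "a \<notin> {0..<int k} \<Longrightarrow> strip_walks k s a = {}"
  unfolding strip_walks_def using start_in_heights by blast

lemma strip_walks_0: "a \<in> {0..<int k} \<Longrightarrow> strip_walks k 0 a = (if a = 0 then {[]} else {})"
  by (auto simp: strip_walks_def)

lemma strip_walks_Suc:
  assumes "a \<in> {0..<int k}"
  shows "strip_walks k (Suc s) a
    = Cons Up ` strip_walks k s (a + 1) \<union> Cons Rt ` strip_walks k s (a - 1)"
proof (intro set_eqI)
  fix p
  show "p \<in> strip_walks k (Suc s) a \<longleftrightarrow>
      p \<in> Cons Up ` strip_walks k s (a + 1) \<union> Cons Rt ` strip_walks k s (a - 1)"
  proof (cases p)
    case (Cons t q)
    then show ?thesis using assms by (cases t) (auto simp: strip_walks_def)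
  qed (auto simp: strip_walks_def)
qed

lemma finite_strip_walks [simp]: "finite (strip_walks k s a)"
proof (cases "a \<in> {0..<int k}")
  case True
  have "strip_walks k s a \<subseteq> {p. set p \<subseteq> {Up, Rt} \<and> length p = s}"
    using step.exhaust by (auto simp: strip_walks_def)
  then show ?thesis
    by (rule finite_subset) (rule finite_lists_length_eq, simp)
qed (simp add: strip_walks_outside)

text \<open>Both sides satisfy the same recursion inside the strip. On the barriers \<open>-1\<close> and \<open>k\<close> the
  right-hand side vanishes: \<open>a\<close> and \<open>a + 2\<close> have then equal distance from \<open>0\<close> on the cycle. Initially the
  right-hand side counts the start \<open>a = 0\<close> only, since \<open>a + 2\<close> lies strictly between \<open>0\<close> and
  \<open>2(k + 1)\<close>.\<close>

lemma card_strip_walks: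
  assumes "k \<ge> 1" and "-1 \<le> a" and "a \<le> int k"
  shows "int (card (strip_walks k s a))
    = cycle_walks (2 * int (k + 1)) s a - cycle_walks (2 * int (k + 1)) s (a + 2)"
  using assms(2,3)
proof (induction s arbitrary: a)
  case (0 a)
  let ?M = "2 * int (k + 1)"
  consider "a = -1" | "a = int k" | "a \<in> {0..<int k}" using 0 by fastforce
  then show ?case
  proof cases
    case 3
    have "\<not> ?M dvd a + 2" using 3 assms(1) zdvd_not_zless[of "a + 2" ?M] by auto
    moreover have "?M dvd a \<longleftrightarrow> a = 0" using 3 zdvd_not_zless[of a ?M] by fastforce
    ultimately show ?thesis using 3 by (simp add: strip_walks_0)
  next
    case 2
    have "cycle_walks ?M 0 (- (a + 2) + ?M) = cycle_walks ?M 0 (a + 2)"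
      by (simp only: cycle_walks_periodic cycle_walks_minus)
    then show ?thesis using 2 by (simp add: strip_walks_outside algebra_simps)
  qed (simp add: strip_walks_outside)
next
  case (Suc s)
  let ?M = "2 * int (k + 1)"
  consider "a = -1" | "a = int k" | "a \<in> {0..<int k}" using Suc.prems by fastforce
  then show ?case
  proof cases
    case 1
    with cycle_walks_minus[of ?M "Suc s" 1] show ?thesis
      by (simp add: strip_walks_outside)
  next
    case 2
    have "cycle_walks ?M (Suc s) (- (a + 2) + ?M) = cycle_walks ?M (Suc s) (a + 2)"
      by (simp only: cycle_walks_periodic cycle_walks_minus)
    moreover have "- (a + 2) + ?M = a" using 2 by simp
    ultimately show ?thesis using 2 by (simp add: strip_walks_outside)
  next
    case 3
    have "card (strip_walks k (Suc s) a)
        = card (strip_walks k s (a + 1)) + card (strip_walks k s (a - 1))"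
      unfolding strip_walks_Suc[OF 3]
      by (subst card_Un_disjoint) (auto simp: card_image)
    then show ?thesis
      using 3 Suc.IH[of "a + 1"] Suc.IH[of "a - 1"] by (simp add: algebra_simps)
  qed
qed

lemma card_closed_strip_walks:
  assumes "k \<ge> 1"
  shows "2 * int (card (strip_walks k (2 * n) 0))
    = 4 * int ((2 * n) choose n) - int ((2 * n + 2) choose (n + 1))
      + 8 * (\<Sum>j = 1..n div (k + 1). int ((2 * n) choose (n - j * (k + 1))))
      - 2 * (\<Sum>j = 1..(n + 1) div (k + 1). int ((2 * n + 2) choose (n + 1 - j * (k + 1))))"
proof -
  let ?W = "cycle_walks (2 * int (k + 1))"
  have "2 * int (card (strip_walks k (2 * n) 0)) = 4 * ?W (2 * n) 0 - ?W (2 * (n + 1)) 0"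
    using card_strip_walks[OF assms, of 0 "2 * n"]
      cycle_walks_two_steps[of "2 * int (k + 1)" "2 * n"] by simp
  also have "\<dots> = 4 * int ((2 * n) choose n) - int ((2 * (n + 1)) choose (n + 1))
      + 8 * (\<Sum>j = 1..n div (k + 1). int ((2 * n) choose (n - j * (k + 1))))
      - 2 * (\<Sum>j = 1..(n + 1) div (k + 1). int ((2 * (n + 1)) choose (n + 1 - j * (k + 1))))"
    by (subst (1 2) cycle_walks_closed) simp_all
  finally show ?thesis by simp
qed

section \<open>Dyck paths as walks in a strip\<close>

lemma visited_not_Nil [simp]: "visited P p \<noteq> []"
  by (cases p) auto

lemma heights_visited:
  "heights (int y - int x) p = map (\<lambda>(x, y). int y - int x) (visited (x, y) p)"
proof (induction p arbitrary: x y)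
  case (Cons s p)
  show ?case
    using Cons[of "y + 1" x] Cons[of y "x + 1"] by (cases s) (simp_all add: algebra_simps)
qed simp

lemma last_visited_sum:
  "fst (last (visited P p)) + snd (last (visited P p)) = fst P + snd P + length p"
proof (induction p arbitrary: P)
  case (Cons s p)
  then show ?case by (cases P; cases s) auto
qed simp

lemma visited_below_last:
  "Q \<in> set (visited P p) \<Longrightarrow> snd Q \<le> snd (last (visited P p))"
proof (induction p arbitrary: P Q)
  case (Cons s p)
  have "move s P \<in> set (visited (move s P) p)" by (cases p) auto
  then have "snd (move s P) \<le> snd (last (visited (move s P) p))"
    using Cons.IH by blast
  moreover have "snd P \<le> snd (move s P)" by (cases P; cases s) auto
  ultimately show ?case using Cons.prems Cons.IH[of Q "move s P"] by auto
qed simp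

lemma dyck_path_heights:
  "dyck_path n p \<longleftrightarrow>
    length p = 2 * n \<and> last (heights 0 p) = 0 \<and> (\<forall>h \<in> set (heights 0 p). 0 \<le> h)"
proof -
  have "last (visited (0, 0) p) = (n, n) \<longleftrightarrow> last (heights 0 p) = 0" if "length p = 2 * n"
    using that last_visited_sum[of "(0, 0)" p] heights_visited[of 0 0 p]
    by (cases "last (visited (0, 0) p)") (auto simp: last_map)
  then show ?thesis
    using heights_visited[of 0 0 p] by (auto simp: dyck_path_def)
qed

lemma hits_or_crosses_heights:
  "hits_or_crosses k p \<longleftrightarrow> (\<exists>h \<in> set (heights 0 p). int k \<le> h)"
proof -
  have "int k \<le> int y - int x \<longleftrightarrow> x + k \<le> y" for x y by linarith
  then show ?thesis
    using heights_visited[of 0 0 p] by (auto simp: hits_or_crosses_def split_beta)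
qed

lemma dyck_path_height_le:
  assumes "dyck_path n p"
  shows "\<not> hits_or_crosses (n + 1) p"
  using assms visited_below_last[of _ "(0, 0)" p]
  by (fastforce simp: dyck_path_def hits_or_crosses_def)

lemma strip_walks_eq_dyck_paths:
  "strip_walks k (2 * n) 0 = {p. dyck_path n p \<and> \<not> hits_or_crosses k p}"
  by (auto simp: strip_walks_def dyck_path_heights hits_or_crosses_heights subset_eq not_le)

lemma B_eq_strip_difference:
  "int (B n k) = int (card (strip_walks (n + 1) (2 * n) 0)) - int (card (strip_walks k (2 * n) 0))"
proof -
  have all: "strip_walks (n + 1) (2 * n) 0 = {p. dyck_path n p}"
    using dyck_path_height_le by (auto simp: strip_walks_eq_dyck_paths)
  have sub: "strip_walks k (2 * n) 0 \<subseteq> strip_walks (n + 1) (2 * n) 0"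
    by (subst all) (auto simp: strip_walks_eq_dyck_paths)
  have "{p. dyck_path n p \<and> hits_or_crosses k p}
      = strip_walks (n + 1) (2 * n) 0 - strip_walks k (2 * n) 0"
    by (subst all) (auto simp: strip_walks_eq_dyck_paths)
  then show ?thesis
    using sub by (simp add: B_def card_Diff_subset card_mono of_nat_diff)
qed

section \<open>The number of Dyck paths reaching a given height\<close>

theorem theorem3p1:
  fixes n k :: nat
  assumes "n \<ge> 1" and "k \<ge> 1"
  shows "int (B n k) =
    (\<Sum>j = 1..(n + 1) div (k + 1). int ((2 * n + 2) choose (n + 1 - j * (k + 1))))
    - 4 * (\<Sum>j = 1..n div (k + 1). int ((2 * n) choose (n - j * (k + 1))))"
proof -
  have "2 * int (card (strip_walks (n + 1) (2 * n) 0))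
      = 4 * int ((2 * n) choose n) - int ((2 * n + 2) choose (n + 1))"
    using card_closed_strip_walks[of "n + 1" n] by simp
  with card_closed_strip_walks[OF assms(2), of n] show ?thesis
    unfolding B_eq_strip_difference by linarith
qed

end
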